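(* Let $r \ge 3$. There exists $t_0 = t_0(r)$ such that for all integers $t \ge t_0$ and all integers $m$ with $\binom{t-1}{r} < m \le \binom{t}{r}$ the following holds. Let $x \ge r-1$ be the real number satisfying $\binom{x}{r} = m$ (so $x$ need not be an integer). Then $$\Lambda(m,r) \le m\, x^{-r},$$ with equality if and only if $x$ is an integer.
   Context: For real $x$, $\binom{x}{r} := x(x-1)\cdots(x-r+1)/r!$. $\mathbb{N} = \{1,2,3,\dots\}$, and $\mathbb{N}^{(r)}$ is the family of all $r$-element subsets of $\mathbb{N}$. An $r$-graph is a finite family $G \subseteq \mathbb{N}^{(r)}$; its members are its edges, and $|G|$ is the number of edges. The Lagrangian of $G$ is $$\lambda(G) := \max\Big\{ \sum_{e \in G} \prod_{x \in e} w(x) \;:\; w(x) \in \mathbb{R}_{\ge 0} \text{ for all } x \in \mathbb{N},\ \sum_{x \in \mathbb{N}} w(x) = 1 \Big\},$$ and $\Lambda(m,r) := \max\{\lambda(G) : G \subseteq \mathbb{N}^{(r)},\ |G| = m\}$. *)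

theory Defs
  imports "HOL-Analysis.Analysis" "HOL-Library.Ramsey"
begin

(* The ground set is the set of positive integers, {1..} :: nat set. *)
definition r_graph :: "nat \<Rightarrow> nat set set \<Rightarrow> bool" where
  "r_graph r G \<longleftrightarrow> finite G \<and> G \<subseteq> nsets {1..} r"

(* Weightings live on {1..}; the value w 0 is irrelevant.  The support may be infinite. *)
definition weighting :: "(nat \<Rightarrow> real) \<Rightarrow> bool" where
  "weighting w \<longleftrightarrow> (\<forall>x\<in>{1..}. 0 \<le> w x) \<and> (w has_sum 1) {1..}"

(* Max is reserved for finite sets, so maxima are written with GREATEST. *)
definition lagrangian :: "nat set set \<Rightarrow> real" where
  "lagrangian G = (GREATEST y. \<exists>w. weighting w \<and> y = (\<Sum>e\<in>G. \<Prod>x\<in>e. w x))"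

definition max_lagrangian :: "nat \<Rightarrow> nat \<Rightarrow> real" where
  "max_lagrangian m r = (GREATEST y. \<exists>G. r_graph r G \<and> card G = m \<and> y = lagrangian G)"

end

theory Submission
  imports Defs
begin

text \<open>
  Let \<open>w\<close> be an optimal weighting of \<open>G\<close> with value \<open>\<lambda>\<close>, choose an edge with probability
  proportional to its weight and order it uniformly at random. The Lagrange condition
  \<open>\<partial>\<^sub>v = r \<lambda> w v\<close> says that each entry of the ordered edge has law \<open>w\<close>. Put \<open>N = exp H(w)\<close>. The
  ordered edge has entropy \<open>ln (r! \<lambda>) + r H(w)\<close>, which is at most \<open>ln (r! m)\<close>, so \<open>\<lambda> \<le> m / N\<^sup>r\<close>.
  Let \<open>N\<^sub>k\<close> be the exponential of the conditional entropy of an entry given \<open>k\<close> others. Mixing two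
  successive entries, which are distinct and exchangeable, gives \<open>N\<^sub>k\<close> at least one more than its
  successor, so \<open>r! \<lambda> N\<^sup>r \<le> N (N - 1) \<cdots> (N - r + 1)\<close>. If \<open>N \<ge> x\<close>, the first bound gives
  \<open>\<lambda> \<le> m / x\<^sup>r\<close>; if \<open>N < x\<close>, the second gives strict inequality. Equality forces \<open>N = x\<close> and
  equality in the mixing step, hence \<open>w\<close> is uniform on its support, which then has \<open>N\<close> elements.
\<close>

section \<open>Entropy of exchangeable tuples with distinct entries\<close>

definition tuples :: "'a set \<Rightarrow> nat \<Rightarrow> 'a list set" where
  "tuples V k = {xs. set xs \<subseteq> V \<and> length xs = k}"

lemma tuples_0 [simp]: "tuples V 0 = {[]}"
  by (auto simp: tuples_def)

lemma sum_tuples_Suc: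
  fixes f :: "'a list \<Rightarrow> 'b :: comm_monoid_add"
  shows "(\<Sum>xs\<in>tuples V (Suc k). f xs) = (\<Sum>xs\<in>tuples V k. \<Sum>v\<in>V. f (v # xs))"
proof -
  have inj: "inj_on (\<lambda>(xs, v). v # xs) (tuples V k \<times> V)"
    by (auto simp: inj_on_def)
  show ?thesis
    unfolding tuples_def lists_length_Suc_eq
    by (subst sum.reindex)
       (use inj in \<open>auto simp: tuples_def sum.cartesian_product case_prod_unfold\<close>)
qed

lemma tuplesD:
  assumes "xs \<in> tuples V k"
  shows "length xs = k" "set xs \<subseteq> V"
  using assms by (auto simp: tuples_def)

text \<open>A single function \<open>b\<close> holds the laws of all prefixes, with the newest entry
  at the head of the list, and \<open>marginal\<close> ties consecutive lengths together up to
  \<open>r\<close>. Exchangeability is imposed on the two newest entries, which is the form that the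
  mixing step uses.\<close>

locale exchangeable_tuples =
  fixes V :: "'a set" and r :: nat and b :: "'a list \<Rightarrow> real"
  assumes finite_V: "finite V"
    and nonneg: "0 \<le> b xs"
    and total: "b [] = 1"
    and marginal: "\<lbrakk>length xs < r; set xs \<subseteq> V\<rbrakk> \<Longrightarrow> (\<Sum>v\<in>V. b (v # xs)) = b xs"
    and swap: "b (u # v # xs) = b (v # u # xs)"
    and repeated: "b (v # v # xs) = 0"
begin

definition ent :: "nat \<Rightarrow> real" where
  "ent k = - (\<Sum>xs\<in>tuples V k. b xs * ln (b xs))"

text \<open>By the chain rule this difference is the conditional entropy of one more entry given
  \<open>k\<close> earlier ones. As a difference it telescopes at once; \<open>cond_ent_eq\<close>
  recovers the usual expression.\<close>

definition cond_ent :: "nat \<Rightarrow> real" where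
  "cond_ent k = ent (Suc k) - ent k"

lemma ent_0: "ent 0 = 0"
  by (simp add: ent_def total)

lemma ent_eq_sum: "ent k = (\<Sum>i<k. cond_ent i)"
  by (simp add: cond_ent_def sum_lessThan_telescope ent_0)

lemma mass: "k \<le> r \<Longrightarrow> (\<Sum>xs\<in>tuples V k. b xs) = 1"
proof (induction k)
  case (Suc k)
  have "(\<Sum>xs\<in>tuples V (Suc k). b xs) = (\<Sum>xs\<in>tuples V k. b xs)"
    unfolding sum_tuples_Suc using Suc.prems by (intro sum.cong refl marginal) (auto simp: tuples_def)
  then show ?case using Suc by simp
qed (simp add: total)

text \<open>One nonnegative term of the marginal sum. It passes positivity from a tuple to its
  tails, so that logarithms of quotients can be split below.\<close>

lemma cons_le:
  assumes "length xs < r" "set xs \<subseteq> V" "v \<in> V"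
  shows "b (v # xs) \<le> b xs"
  using member_le_sum[of v V "\<lambda>v. b (v # xs)"] marginal[OF assms(1,2)] assms(3) finite_V nonneg
  by auto

text \<open>Chain rule: \<open>marginal\<close> spreads \<open>b xs * ln (b xs)\<close> over the
  one-entry extensions of \<open>xs\<close>.\<close>

lemma cond_ent_eq:
  assumes "k < r"
  shows "cond_ent k = (\<Sum>xs\<in>tuples V k. \<Sum>v\<in>V. b (v # xs) * ln (b xs / b (v # xs)))"
proof -
  have "(\<Sum>v\<in>V. b (v # xs) * ln (b xs / b (v # xs)))
      = b xs * ln (b xs) - (\<Sum>v\<in>V. b (v # xs) * ln (b (v # xs)))" if "xs \<in> tuples V k" for xs
  proof -
    have xs: "length xs < r" "set xs \<subseteq> V" using that assms by (auto dest: tuplesD)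
    have "b (v # xs) * ln (b xs / b (v # xs)) = b (v # xs) * ln (b xs) - b (v # xs) * ln (b (v # xs))"
      if "v \<in> V" for v
    proof (cases "b (v # xs) = 0")
      case False
      then have "0 < b (v # xs)" "0 < b xs"
        using nonneg[of "v # xs"] cons_le[OF xs that] by linarith+
      then show ?thesis by (simp add: ln_div algebra_simps)
    qed simp
    then have "(\<Sum>v\<in>V. b (v # xs) * ln (b xs / b (v # xs)))
      = (\<Sum>v\<in>V. b (v # xs)) * ln (b xs) - (\<Sum>v\<in>V. b (v # xs) * ln (b (v # xs)))"
      by (simp add: sum_subtractf sum_distrib_right)
    then show ?thesis using marginal[OF xs] by simp
  qed
  then show ?thesis
    unfolding cond_ent_def ent_def sum_tuples_Suc by (simp add: sum_subtractf)
qed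

text \<open>
  Given a prefix \<open>xs\<close>, let \<open>Z\<close> be the next entry with probability \<open>q\<close> and the one after it
  otherwise; by exchangeability \<open>Z\<close> has the law of the next entry. \<open>D\<close> is \<open>- b (u # xs)\<close> times
  the divergence of the law of \<open>Z\<close>, given that the next entry is \<open>u\<close>, from this law.
  Distinctness of the entries makes the two parts of the mixture disjoint.
\<close>
lemma mixture_divergence:
  assumes xs: "Suc (length xs) < r" "set xs \<subseteq> V" and u: "u \<in> V" and q: "0 < q" "q < 1"
  defines "D \<equiv> q * b (u # xs) * ln (b (u # xs) / (b xs * q))
      + (1 - q) * (\<Sum>z\<in>V. b (z # u # xs) *
          ln (b (z # xs) * b (u # xs) / (b xs * (1 - q) * b (z # u # xs))))"
  shows "D \<le> 0" and "D = 0 \<Longrightarrow> 0 < b (u # xs) \<Longrightarrow> b (u # xs) = q * b xs"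
proof -
  define B where "B = b (u # xs)"
  define A where "A = b xs"
  have "D \<le> 0 \<and> (D = 0 \<longrightarrow> 0 < B \<longrightarrow> B = q * A)"
  proof (cases "B = 0")
    case True
    have "b (z # u # xs) = 0" if "z \<in> V" for z
      using cons_le[of "u # xs" z] nonneg[of "z # u # xs"] that xs u True B_def by auto
    then show ?thesis using True by (simp add: D_def B_def[symmetric])
  next
    case False
    have BA: "0 < B" "B \<le> A"
      using False nonneg[of "u # xs"] cons_le[of xs u] xs u by (auto simp: A_def B_def)
    then have A: "0 < A" by linarith
    let ?t = "\<lambda>z. (1 - q) * (b (z # u # xs) *
        ln (b (z # xs) * B / (A * (1 - q) * b (z # u # xs))))"
    \<comment> \<open>Termwise Gibbs inequality: \<open>ln y \<le> y - 1\<close>, multiplied by the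
      mass \<open>(1 - q) * b (z # u # xs)\<close>.\<close>
    have t: "?t z \<le> b (z # xs) * (B / A) - (1 - q) * b (z # u # xs)" if "z \<in> V" for z
    proof (cases "b (z # u # xs) = 0")
      case True
      then show ?thesis using BA A nonneg[of "z # xs"] by simp
    next
      case False
      have pos: "0 < b (z # u # xs)" using False nonneg[of "z # u # xs"] by linarith
      moreover have "b (z # u # xs) \<le> b (z # xs)"
        using cons_le[of "z # xs" u] swap[of z u xs] xs u that by auto
      ultimately have pos': "0 < b (z # xs)" by linarith
      let ?y = "b (z # xs) * B / (A * (1 - q) * b (z # u # xs))"
      have "0 < ?y" using pos pos' A BA q by simp
      then have "ln ?y \<le> ?y - 1" by (rule ln_le_minus_one)
      then have "((1 - q) * b (z # u # xs)) * ln ?y \<le> ((1 - q) * b (z # u # xs)) * (?y - 1)"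
        using pos q by (intro mult_left_mono) auto
      also have "\<dots> = b (z # xs) * (B / A) - (1 - q) * b (z # u # xs)"
        using pos q A by (simp add: field_simps)
      finally show ?thesis by (simp add: mult.assoc)
    qed
    \<comment> \<open>Distinctness enters here. The term at \<open>u\<close> vanishes and is split
      off before the linear bound is applied, which saves \<open>B * (B / A)\<close>.\<close>
    have tu: "?t u = 0" by (simp add: repeated)
    have "(\<Sum>z\<in>V. ?t z) = (\<Sum>z\<in>V - {u}. ?t z)"
      using finite_V u tu by (simp add: sum.remove[of V u])
    also have "\<dots> \<le> (\<Sum>z\<in>V - {u}. b (z # xs) * (B / A) - (1 - q) * b (z # u # xs))"
      by (intro sum_mono t) auto
    also have "\<dots> = (\<Sum>z\<in>V. b (z # xs) * (B / A) - (1 - q) * b (z # u # xs)) - B * (B / A)"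
      using finite_V u by (simp add: sum.remove[of V u] repeated B_def)
    also have "\<dots> = q * B - B * (B / A)"
    proof -
      have "(\<Sum>z\<in>V. b (z # xs)) = A" "(\<Sum>z\<in>V. b (z # u # xs)) = B"
        using marginal[of xs] marginal[of "u # xs"] xs u by (auto simp: A_def B_def)
      then have "(\<Sum>z\<in>V. b (z # xs) * (B / A) - (1 - q) * b (z # u # xs)) = A * (B / A) - (1 - q) * B"
        by (simp add: sum_subtractf sum_distrib_left[symmetric] sum_distrib_right[symmetric] del: times_divide_eq_right)
      then show ?thesis using A by (simp add: field_simps)
    qed
    finally have T: "(\<Sum>z\<in>V. ?t z) \<le> q * B - B * (B / A)" .
    \<comment> \<open>The other part of the mixture, \<open>Z = u\<close>. Its linear bound
      \<open>B * (B / A) - q * B\<close> cancels the bound just obtained exactly, so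
      \<open>D = 0\<close> forces equality in \<open>ln ?x \<le> ?x - 1\<close>, that is
      \<open>?x = 1\<close>.\<close>
    let ?x = "B / (A * q)"
    have x: "0 < ?x" using BA A q by simp
    have D: "D = q * B * ln ?x + (\<Sum>z\<in>V. ?t z)"
      by (simp add: D_def A_def B_def sum_distrib_left)
    have e: "q * B * (?x - 1) = B * (B / A) - q * B"
      using A q by (simp add: field_simps)
    have "q * B * ln ?x \<le> q * B * (?x - 1)"
      using ln_le_minus_one[OF x] BA q by (intro mult_left_mono) auto
    then have 1: "D \<le> 0" using D T e by linarith
    have 2: "B = q * A" if "D = 0"
    proof -
      have "q * B * (?x - 1) \<le> q * B * ln ?x" using D T e that by linarith
      then have "?x - 1 \<le> ln ?x" using BA q by (simp add: mult_le_cancel_left)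
      then have "?x = 1" using ln_eq_minus_one[OF x] ln_le_minus_one[OF x] by linarith
      then show ?thesis using A q by (simp add: field_simps)
    qed
    show ?thesis using 1 2 by blast
  qed
  then show "D \<le> 0" "D = 0 \<Longrightarrow> 0 < b (u # xs) \<Longrightarrow> b (u # xs) = q * b xs"
    by (auto simp: A_def B_def)
qed

text \<open>The mixing step. The sum of the nonpositive quantities \<open>D\<close> over prefixes
  and next entries equals \<open>ln (1 + c) - cond_ent k\<close>. If that is zero, every
  \<open>D\<close> vanishes, and the next entry is then uniform on its support given the
  prefix.\<close>

lemma exp_cond_ent_Suc:
  assumes k: "Suc k < r"
  shows "exp (cond_ent (Suc k)) + 1 \<le> exp (cond_ent k)" (is ?le)
    and "exp (cond_ent (Suc k)) + 1 = exp (cond_ent k) \<Longrightarrow> xs \<in> tuples V k \<Longrightarrow> u \<in> V \<Longrightarrow>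
      0 < b (u # xs) \<Longrightarrow> b xs = exp (cond_ent k) * b (u # xs)"
proof -
  define c where "c = exp (cond_ent (Suc k))"
  \<comment> \<open>The sum of all \<open>D\<close> is the binary entropy of \<open>q\<close> plus
    \<open>(1 - q) * cond_ent (Suc k) - cond_ent k\<close>. This choice of \<open>q\<close>
    maximizes it, with value \<open>ln (1 + c) - cond_ent k\<close>.\<close>
  define q where "q = 1 / (1 + c)"
  have c: "0 < c" by (simp add: c_def)
  then have q: "0 < q" "q < 1" by (auto simp: q_def)
  define D where "D xs u = q * b (u # xs) * ln (b (u # xs) / (b xs * q))
      + (1 - q) * (\<Sum>z\<in>V. b (z # u # xs) *
          ln (b (z # xs) * b (u # xs) / (b xs * (1 - q) * b (z # u # xs))))" for xs u
  have D_split: "D xs u = - q * (b (u # xs) * ln (b xs / b (u # xs))) - q * ln q * b (u # xs)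
      + (1 - q) * (- (\<Sum>z\<in>V. b (z # u # xs) * ln (b xs / b (z # xs)))
         + (\<Sum>z\<in>V. b (z # u # xs) * ln (b (u # xs) / b (z # u # xs)))
         - ln (1 - q) * b (u # xs))"
    if xs: "xs \<in> tuples V k" and u: "u \<in> V" for xs u
  proof -
    have xs': "Suc (length xs) < r" "set xs \<subseteq> V" using xs k by (auto dest: tuplesD)
    have 1: "q * b (u # xs) * ln (b (u # xs) / (b xs * q))
        = - q * (b (u # xs) * ln (b xs / b (u # xs))) - q * ln q * b (u # xs)"
    proof (cases "b (u # xs) = 0")
      case False
      then have "0 < b (u # xs)" "0 < b xs"
        using nonneg[of "u # xs"] cons_le[of xs u] xs' u by fastforce+
      then show ?thesis using q by (simp add: ln_div ln_mult algebra_simps)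
    qed simp
    have "b (z # u # xs) * ln (b (z # xs) * b (u # xs) / (b xs * (1 - q) * b (z # u # xs)))
      = - (b (z # u # xs) * ln (b xs / b (z # xs)))
        + b (z # u # xs) * ln (b (u # xs) / b (z # u # xs)) - ln (1 - q) * b (z # u # xs)"
      if z: "z \<in> V" for z
    proof (cases "b (z # u # xs) = 0")
      case False
      have "0 < b (z # u # xs)" using False nonneg[of "z # u # xs"] by linarith
      moreover have "b (z # u # xs) \<le> b (u # xs)" "b (z # u # xs) \<le> b (z # xs)" "b (u # xs) \<le> b xs"
        using cons_le[of "u # xs" z] cons_le[of "z # xs" u] cons_le[of xs u] swap[of z u xs] xs' u z
        by auto
      ultimately have "0 < b (z # u # xs)" "0 < b (u # xs)" "0 < b (z # xs)" "0 < b xs" by linarith+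
      then have ln_eq: "ln (b (z # xs) * b (u # xs) / (b xs * (1 - q) * b (z # u # xs)))
        = ln (b (u # xs) / b (z # u # xs)) - ln (b xs / b (z # xs)) - ln (1 - q)"
        using q by (simp add: ln_div ln_mult)
      show ?thesis unfolding ln_eq by (simp add: algebra_simps)
    qed simp
    moreover have "(\<Sum>z\<in>V. b (z # u # xs)) = b (u # xs)" using marginal[of "u # xs"] xs' u by auto
    ultimately have "(\<Sum>z\<in>V. b (z # u # xs) * ln (b (z # xs) * b (u # xs) / (b xs * (1 - q) * b (z # u # xs))))
      = - (\<Sum>z\<in>V. b (z # u # xs) * ln (b xs / b (z # xs)))
         + (\<Sum>z\<in>V. b (z # u # xs) * ln (b (u # xs) / b (z # u # xs)))
         - ln (1 - q) * b (u # xs)"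
      by (simp add: sum.distrib sum_subtractf sum_negf sum_distrib_left[symmetric])
    then show ?thesis unfolding D_def 1 by simp
  qed
  \<comment> \<open>The cross term scores the later entry \<open>z\<close> by its law as the next
    entry after \<open>xs\<close>. Swapping \<open>u\<close> and \<open>z\<close> makes
    \<open>u\<close> the newest entry, which is then summed out and leaves
    \<open>cond_ent k\<close>.\<close>
  have exch: "(\<Sum>xs\<in>tuples V k. \<Sum>u\<in>V. \<Sum>z\<in>V. b (z # u # xs) * ln (b xs / b (z # xs))) = cond_ent k"
  proof -
    have "(\<Sum>u\<in>V. \<Sum>z\<in>V. b (z # u # xs) * ln (b xs / b (z # xs)))
        = (\<Sum>z\<in>V. b (z # xs) * ln (b xs / b (z # xs)))" if xs: "xs \<in> tuples V k" for xs
    proof -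
      have "(\<Sum>u\<in>V. \<Sum>z\<in>V. b (z # u # xs) * ln (b xs / b (z # xs)))
          = (\<Sum>z\<in>V. (\<Sum>u\<in>V. b (u # z # xs)) * ln (b xs / b (z # xs)))"
        unfolding sum_distrib_right by (subst sum.swap) (simp add: swap)
      also have "\<dots> = (\<Sum>z\<in>V. b (z # xs) * ln (b xs / b (z # xs)))"
        using xs k by (intro sum.cong refl arg_cong2[of _ _ _ _ times] marginal) (auto simp: tuples_def)
      finally show ?thesis .
    qed
    then show ?thesis using k by (simp add: cond_ent_eq)
  qed
  have m: "(\<Sum>xs\<in>tuples V k. \<Sum>u\<in>V. b (u # xs)) = 1"
    using mass[of "Suc k"] k by (simp add: sum_tuples_Suc)
  have "(\<Sum>xs\<in>tuples V k. \<Sum>u\<in>V. D xs u)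
    = - q * cond_ent k - q * ln q
      + (1 - q) * (- cond_ent k + cond_ent (Suc k) - ln (1 - q))"
  proof -
    have "(\<Sum>xs\<in>tuples V k. \<Sum>u\<in>V. D xs u)
      = - q * (\<Sum>xs\<in>tuples V k. \<Sum>u\<in>V. b (u # xs) * ln (b xs / b (u # xs)))
        - q * ln q * (\<Sum>xs\<in>tuples V k. \<Sum>u\<in>V. b (u # xs))
        + (1 - q) * (- (\<Sum>xs\<in>tuples V k. \<Sum>u\<in>V. \<Sum>z\<in>V. b (z # u # xs) * ln (b xs / b (z # xs)))
         + (\<Sum>xs\<in>tuples V k. \<Sum>u\<in>V. \<Sum>z\<in>V. b (z # u # xs) * ln (b (u # xs) / b (z # u # xs)))
         - ln (1 - q) * (\<Sum>xs\<in>tuples V k. \<Sum>u\<in>V. b (u # xs)))"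
      by (simp add: D_split sum.distrib sum_subtractf sum_negf sum_distrib_left[symmetric])
    also have "(\<Sum>xs\<in>tuples V k. \<Sum>u\<in>V. \<Sum>z\<in>V. b (z # u # xs) * ln (b (u # xs) / b (z # u # xs)))
        = cond_ent (Suc k)"
      using k by (simp add: cond_ent_eq sum_tuples_Suc)
    also have "(\<Sum>xs\<in>tuples V k. \<Sum>u\<in>V. b (u # xs) * ln (b xs / b (u # xs))) = cond_ent k"
      using k by (simp add: cond_ent_eq)
    finally show ?thesis unfolding exch m by simp
  qed
  also have "\<dots> = ln (1 + c) - cond_ent k"
  proof -
    have ln_q: "ln q = - ln (1 + c)" using c by (simp add: q_def ln_div)
    have "1 - q = c / (1 + c)" using c by (simp add: q_def field_simps)
    then have "ln (1 - q) = ln c - ln (1 + c)" using c by (simp add: ln_div)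
    then have ln_1q: "ln (1 - q) = cond_ent (Suc k) - ln (1 + c)" by (simp add: c_def)
    show ?thesis unfolding ln_q ln_1q by (simp add: algebra_simps)
  qed
  finally have sumD: "(\<Sum>xs\<in>tuples V k. \<Sum>u\<in>V. D xs u) = ln (1 + c) - cond_ent k" .
  have D_le: "D xs u \<le> 0" if "xs \<in> tuples V k" "u \<in> V" for xs u
    unfolding D_def using mixture_divergence(1)[of xs u q] that k q by (auto dest: tuplesD)
  then have "ln (1 + c) \<le> cond_ent k" using sumD sum_nonpos[of "tuples V k" "\<lambda>xs. \<Sum>u\<in>V. D xs u"]
    by (auto intro!: sum_nonpos)
  then have "exp (ln (1 + c)) \<le> exp (cond_ent k)" by (simp only: exp_le_cancel_iff)
  moreover have "exp (ln (1 + c)) = 1 + c" using c by simp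
  ultimately show ?le unfolding c_def by linarith
  show "b xs = exp (cond_ent k) * b (u # xs)"
    if eq: "exp (cond_ent (Suc k)) + 1 = exp (cond_ent k)"
      and xs: "xs \<in> tuples V k" and u: "u \<in> V" and pos: "0 < b (u # xs)"
  proof -
    have eq': "1 + c = exp (cond_ent k)" using eq by (simp add: c_def)
    \<comment> \<open>A vanishing double sum of nonnegative terms has only zero terms.\<close>
    have "(\<Sum>xs\<in>tuples V k. \<Sum>u\<in>V. - D xs u) = 0" using sumD eq' by (simp add: sum_negf)
    moreover have "finite (tuples V k)" by (simp add: tuples_def finite_lists_length_eq finite_V)
    moreover have "0 \<le> (\<Sum>u\<in>V. - D ys u)" if "ys \<in> tuples V k" for ys
      using D_le[OF that] by (intro sum_nonneg) simp
    ultimately have "\<forall>ys\<in>tuples V k. (\<Sum>u\<in>V. - D ys u) = 0"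
      using sum_nonneg_eq_0_iff[of "tuples V k" "\<lambda>ys. \<Sum>u\<in>V. - D ys u"] by blast
    then have "(\<Sum>u\<in>V. - D xs u) = 0" using xs by blast
    moreover have "0 \<le> - D xs u" if "u \<in> V" for u using D_le[OF xs that] by simp
    ultimately have "\<forall>u\<in>V. - D xs u = 0"
      using sum_nonneg_eq_0_iff[of V "\<lambda>u. - D xs u"] finite_V by blast
    then have "D xs u = 0" using u by simp
    then have "b (u # xs) = q * b xs"
      using mixture_divergence(2)[of xs u q] xs u pos q k unfolding D_def by (auto dest: tuplesD)
    then show ?thesis using c eq' by (simp add: q_def)
  qed
qed

text \<open>The factors \<open>exp (cond_ent k)\<close> start at \<open>N\<close> and drop by at
  least 1 each time, so the one with index \<open>k\<close> is at most \<open>N - real k\<close>;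
  their product is \<open>exp (ent r)\<close>.\<close>

lemma exp_ent_le:
  defines "N \<equiv> exp (ent 1)"
  shows "k < r \<Longrightarrow> real k < N"
    and "exp (ent r) \<le> (\<Prod>k<r. N - real k)"
    and "2 \<le> r \<Longrightarrow> exp (ent r) = (\<Prod>k<r. N - real k) \<Longrightarrow> v \<in> V \<Longrightarrow> 0 < b [v] \<Longrightarrow> b [v] = 1 / N"
proof -
  have c0: "exp (cond_ent 0) = N" by (simp add: N_def cond_ent_def ent_0)
  have le: "exp (cond_ent k) \<le> N - real k" if "k < r" for k
    using that
  proof (induction k)
    case (Suc k)
    then show ?case using exp_cond_ent_Suc(1)[of k] by simp
  qed (simp add: c0)
  show k: "real k < N" if "k < r" for k
    using le[OF that] exp_gt_zero[of "cond_ent k"] by linarith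
  have ent_r: "exp (ent r) = (\<Prod>k<r. exp (cond_ent k))"
    by (simp add: ent_eq_sum exp_sum)
  show "exp (ent r) \<le> (\<Prod>k<r. N - real k)"
    unfolding ent_r by (intro prod_mono) (auto intro: le)
  show "b [v] = 1 / N"
    if r: "2 \<le> r" and eq: "exp (ent r) = (\<Prod>k<r. N - real k)" and v: "v \<in> V" "0 < b [v]"
  proof -
    \<comment> \<open>All factors are positive, so a single strict one would make the products
      differ. The factor with index 1 exists because \<open>2 \<le> r\<close>; it gives the equality
      case of the mixing step for the empty prefix.\<close>
    have "\<not> exp (cond_ent 1) < N - real 1"
    proof
      assume "exp (cond_ent 1) < N - real 1"
      then have "(\<Prod>k<r. exp (cond_ent k)) < (\<Prod>k<r. N - real k)"
        using r by (intro prod_mono_strict[of 1]) (auto intro: le k simp: diff_gt_0_iff_gt)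
      then show False using eq ent_r by simp
    qed
    then have "exp (cond_ent (Suc 0)) + 1 = exp (cond_ent 0)"
      using le[of 1] r c0 by simp
    from exp_cond_ent_Suc(2)[OF _ this, of "[]" v] show ?thesis
      using r v c0 total by (auto simp: field_simps N_def)
  qed
qed

text \<open>The fixed entry \<open>v\<close> is the newest one. \<open>swap\<close> moves it behind
  the entry next to it, which \<open>marginal\<close> then sums out.\<close>

lemma sum_tuples_append:
  assumes "k < r" "v \<in> V"
  shows "(\<Sum>xs\<in>tuples V k. b (v # xs)) = b [v]"
  using assms
proof (induction k)
  case (Suc k)
  have "(\<Sum>xs\<in>tuples V (Suc k). b (v # xs)) = (\<Sum>xs\<in>tuples V k. \<Sum>u\<in>V. b (u # v # xs))"
    by (simp add: sum_tuples_Suc swap)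
  also have "\<dots> = (\<Sum>xs\<in>tuples V k. b (v # xs))"
    using Suc.prems by (intro sum.cong marginal) (auto simp: tuples_def)
  finally show ?case using Suc by simp
qed simp

text \<open>Linearity of expectation: each of the \<open>k\<close> entries has the law of the
  first.\<close>

lemma sum_tuples_sum_list:
  "k \<le> r \<Longrightarrow> (\<Sum>xs\<in>tuples V k. b xs * sum_list (map g xs)) = real k * (\<Sum>v\<in>V. b [v] * g v)"
proof (induction k)
  case (Suc k)
  have "(\<Sum>xs\<in>tuples V (Suc k). b xs * sum_list (map g xs))
     = (\<Sum>xs\<in>tuples V k. \<Sum>v\<in>V. b (v # xs) * g v)
       + (\<Sum>xs\<in>tuples V k. (\<Sum>v\<in>V. b (v # xs)) * sum_list (map g xs))"
    by (simp add: sum_tuples_Suc distrib_left sum.distrib sum_distrib_right)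
  also have "(\<Sum>xs\<in>tuples V k. \<Sum>v\<in>V. b (v # xs) * g v)
      = (\<Sum>v\<in>V. (\<Sum>xs\<in>tuples V k. b (v # xs)) * g v)"
    unfolding sum_distrib_right by (rule sum.swap)
  also have "\<dots> = (\<Sum>v\<in>V. b [v] * g v)"
    using Suc.prems by (intro sum.cong) (auto simp: sum_tuples_append)
  also have "(\<Sum>xs\<in>tuples V k. (\<Sum>v\<in>V. b (v # xs)) * sum_list (map g xs))
      = (\<Sum>xs\<in>tuples V k. b xs * sum_list (map g xs))"
    using Suc.prems by (intro sum.cong refl arg_cong2[of _ _ _ _ times] marginal) (auto simp: tuples_def)
  finally show ?case using Suc by (simp add: algebra_simps)
qed simp

end

section \<open>Optimal weightings\<close>

definition edge_poly :: "nat set set \<Rightarrow> (nat \<Rightarrow> real) \<Rightarrow> real" where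
  "edge_poly G w = (\<Sum>e\<in>G. \<Prod>x\<in>e. w x)"

text \<open>A finite-dimensional problem on the vertices of \<open>G\<close> alone, which replaces
  weightings of possibly infinite support; \<open>lagrangian_eq\<close> shows that its maximum is
  the Lagrangian.\<close>

definition optimal_weights :: "nat set set \<Rightarrow> (nat \<Rightarrow> real) \<Rightarrow> bool" where
  "optimal_weights G w \<longleftrightarrow> (\<forall>v\<in>\<Union>G. 0 \<le> w v) \<and> (\<Sum>v\<in>\<Union>G. w v) = 1 \<and>
     (\<forall>u. (\<forall>v\<in>\<Union>G. 0 \<le> u v) \<longrightarrow> (\<Sum>v\<in>\<Union>G. u v) = 1 \<longrightarrow> edge_poly G u \<le> edge_poly G w)"

lemma optimal_weightsD:
  assumes "optimal_weights G w"
  shows "\<And>v. v \<in> \<Union>G \<Longrightarrow> 0 \<le> w v" and "(\<Sum>v\<in>\<Union>G. w v) = 1"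
    and "(\<And>v. v \<in> \<Union>G \<Longrightarrow> 0 \<le> u v) \<Longrightarrow> (\<Sum>v\<in>\<Union>G. u v) = 1 \<Longrightarrow> edge_poly G u \<le> edge_poly G w"
proof -
  show "0 \<le> w v" if "v \<in> \<Union>G" for v
    using assms[unfolded optimal_weights_def, THEN conjunct1] that by (rule bspec)
  show "(\<Sum>v\<in>\<Union>G. w v) = 1"
    by (rule assms[unfolded optimal_weights_def, THEN conjunct2, THEN conjunct1])
  show "edge_poly G u \<le> edge_poly G w"
    if u: "\<And>v. v \<in> \<Union>G \<Longrightarrow> 0 \<le> u v" "(\<Sum>v\<in>\<Union>G. u v) = 1"
  proof -
    have "\<forall>v\<in>\<Union>G. 0 \<le> u v" using u(1) by (rule ballI)
    then show ?thesis
      using assms[unfolded optimal_weights_def, THEN conjunct2, THEN conjunct2] u(2) by metis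
  qed
qed

lemma r_graphD:
  assumes "r_graph r G"
  shows "finite G" "\<Union>G \<subseteq> {1..}" "e \<in> G \<Longrightarrow> finite e" "e \<in> G \<Longrightarrow> card e = r"
  using assms by (auto simp: r_graph_def nsets_def)

lemma finite_Union_r_graph: "r_graph r G \<Longrightarrow> finite (\<Union>G)"
  by (auto dest: r_graphD)

lemma edge_prod_nonneg:
  fixes w :: "'a \<Rightarrow> real"
  assumes w: "\<And>v. v \<in> \<Union>G \<Longrightarrow> 0 \<le> w v" and e: "e \<in> G"
  shows "0 \<le> (\<Prod>x\<in>e. w x)"
  by (intro prod_nonneg w UnionI[OF e])

lemma edge_poly_nonneg: "(\<And>v. v \<in> \<Union>G \<Longrightarrow> 0 \<le> w v) \<Longrightarrow> 0 \<le> edge_poly G w"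
  unfolding edge_poly_def by (intro sum_nonneg edge_prod_nonneg)

lemma edge_poly_cong: "(\<And>v. v \<in> \<Union>G \<Longrightarrow> w v = u v) \<Longrightarrow> edge_poly G w = edge_poly G u"
  unfolding edge_poly_def by (intro sum.cong prod.cong) auto

lemma edge_poly_scale:
  assumes "r_graph r G"
  shows "edge_poly G (\<lambda>v. c * w v) = c ^ r * edge_poly G w"
proof -
  have "(\<Prod>x\<in>e. c * w x) = c ^ r * (\<Prod>x\<in>e. w x)" if "e \<in> G" for e
    using r_graphD(4)[OF assms that] by (simp add: prod.distrib)
  then show ?thesis by (simp add: edge_poly_def sum_distrib_left)
qed

text \<open>Homogeneity of degree \<open>r\<close> removes the normalization, so later test weights
  and perturbations need not have sum 1.\<close>

lemma optimal_weights_bound: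
  assumes G: "r_graph r G" and r: "r \<noteq> 0" and w: "optimal_weights G w"
    and u: "\<And>v. v \<in> \<Union>G \<Longrightarrow> 0 \<le> u v"
  shows "edge_poly G u \<le> edge_poly G w * (\<Sum>v\<in>\<Union>G. u v) ^ r"
proof (cases "(\<Sum>v\<in>\<Union>G. u v) = 0")
  case True
  then have "edge_poly G u = edge_poly G (\<lambda>v. 0 * u v)"
    using sum_nonneg_eq_0_iff[of "\<Union>G" u] u finite_Union_r_graph[OF G]
    by (intro edge_poly_cong) auto
  also have "\<dots> = 0" unfolding edge_poly_scale[OF G] using r by simp
  finally show ?thesis using r True by (simp add: power_0_left)
next
  case False
  define c where "c = (\<Sum>v\<in>\<Union>G. u v)"
  have c: "0 < c" using False u sum_nonneg[of "\<Union>G" u] by (auto simp: c_def)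
  have "edge_poly G (\<lambda>v. inverse c * u v) \<le> edge_poly G w"
  proof (rule optimal_weightsD(3)[OF w])
    show "0 \<le> inverse c * u v" if "v \<in> \<Union>G" for v using u[OF that] c by simp
    show "(\<Sum>v\<in>\<Union>G. inverse c * u v) = 1"
      using c by (simp add: sum_distrib_left[symmetric] c_def[symmetric])
  qed
  then have "edge_poly G u / c ^ r \<le> edge_poly G w"
    unfolding edge_poly_scale[OF G] by (simp only: power_inverse divide_inverse mult.commute)
  then show ?thesis using c by (simp add: c_def[symmetric] pos_divide_le_eq)
qed

text \<open>Extending \<open>w\<close> by 0 gives a weighting with the same value. Conversely, a
  weighting puts mass at most 1 on the vertices, and the homogeneous bound applies.\<close>

lemma lagrangian_eq:
  assumes G: "r_graph r G" and r: "r \<noteq> 0" and w: "optimal_weights G w"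
  shows "lagrangian G = edge_poly G w"
  unfolding lagrangian_def edge_poly_def[symmetric]
proof (rule Greatest_equality)
  have V: "finite (\<Union>G)" "\<Union>G \<subseteq> {1..}" using finite_Union_r_graph[OF G] r_graphD[OF G] by auto
  define w' where "w' v = (if v \<in> \<Union>G then w v else 0)" for v
  have "(w' has_sum 1) {1..}"
    using optimal_weightsD(2)[OF w] V
    by (intro has_sum_finite_neutralI[of "\<Union>G"]) (auto simp: w'_def)
  moreover have "edge_poly G w = edge_poly G w'"
    by (intro edge_poly_cong) (simp add: w'_def)
  ultimately show "\<exists>w'. weighting w' \<and> edge_poly G w = edge_poly G w'"
    using optimal_weightsD(1)[OF w] by (auto simp: weighting_def w'_def intro!: exI[of _ w'])
  show "y \<le> edge_poly G w" if y: "\<exists>w. weighting w \<and> y = edge_poly G w" for y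
  proof -
    obtain u where u: "weighting u" "y = edge_poly G u" using y by blast
    have u0: "0 \<le> u v" if "v \<in> \<Union>G" for v using u V that by (auto simp: weighting_def)
    have "(\<Sum>v\<in>\<Union>G. u v) \<le> 1"
      using u V by (intro finite_sum_le_has_sum[where A = "{1..}"]) (auto simp: weighting_def)
    then have "(\<Sum>v\<in>\<Union>G. u v) ^ r \<le> 1" using u0 by (intro power_le_one sum_nonneg) auto
    moreover have "0 \<le> edge_poly G w"
      using optimal_weightsD(1)[OF w] by (rule edge_poly_nonneg)
    ultimately have "edge_poly G w * (\<Sum>v\<in>\<Union>G. u v) ^ r \<le> edge_poly G w"
      by (simp add: mult_left_le)
    moreover have "edge_poly G u \<le> edge_poly G w * (\<Sum>v\<in>\<Union>G. u v) ^ r"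
      using u0 by (rule optimal_weights_bound[OF G r w])
    ultimately show ?thesis using u(2) by linarith
  qed
qed

lemma optimal_weights_exist:
  assumes G: "r_graph r G" and r: "r \<noteq> 0" and ne: "G \<noteq> {}"
  obtains w where "optimal_weights G w"
proof -
  define V where "V = \<Union>G"
  have V: "finite V" using finite_Union_r_graph[OF G] by (simp add: V_def)
  obtain v0 where v0: "v0 \<in> V"
  proof -
    obtain e where e: "e \<in> G" using ne by blast
    then have "e \<noteq> {}" using r_graphD[OF G] r by fastforce
    then show ?thesis using that e by (auto simp: V_def)
  qed
  \<comment> \<open>Pinning the coordinates outside \<open>V\<close> to 0 makes \<open>S\<close> a
    product of compact sets, so compactness of the simplex \<open>T\<close> follows from Tychonoff's
    theorem.\<close>
  define S :: "(nat \<Rightarrow> real) set" where "S = Pi\<^sub>E UNIV (\<lambda>v. if v \<in> V then {0..1} else {0})"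
  define T where "T = S \<inter> {w. (\<Sum>v\<in>V. w v) = 1}"
  have "compactin (product_topology (\<lambda>i::nat. euclidean :: real topology) UNIV) S"
    unfolding S_def by (subst compactin_PiE) auto
  then have S: "compact S" by (simp add: euclidean_product_topology)
  have coord: "continuous_on A (\<lambda>w :: nat \<Rightarrow> real. w i)" for A i
    by (rule continuous_on_subset[OF continuous_on_product_coordinates]) simp
  have "closed {w :: nat \<Rightarrow> real. (\<Sum>v\<in>V. w v) = 1}"
    by (intro closed_Collect_eq continuous_on_sum coord continuous_on_const)
  then have T: "compact T" unfolding T_def using S by (intro compact_Int_closed)
  have "(\<lambda>v. if v = v0 then 1 else 0) \<in> T"
    using v0 V by (auto simp: T_def S_def)
  then have "T \<noteq> {}" by blast
  moreover have "continuous_on T (edge_poly G)"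
    unfolding edge_poly_def by (intro continuous_on_sum continuous_on_prod coord)
  ultimately obtain w where w: "w \<in> T" "\<And>u. u \<in> T \<Longrightarrow> edge_poly G u \<le> edge_poly G w"
    using continuous_attains_sup[OF T] by blast
  have "optimal_weights G w"
    unfolding optimal_weights_def V_def[symmetric]
  proof (intro conjI ballI allI impI)
    show "0 \<le> w v" if "v \<in> V" for v
      using w(1) that by (auto simp: T_def S_def PiE_def Pi_def split: if_splits)
    show "(\<Sum>v\<in>V. w v) = 1" using w(1) by (simp add: T_def)
    fix u :: "nat \<Rightarrow> real" assume u: "\<forall>v\<in>V. 0 \<le> u v" "(\<Sum>v\<in>V. u v) = 1"
    define u' where "u' v = (if v \<in> V then u v else 0)" for v
    have "u v \<le> 1" if "v \<in> V" for v using member_le_sum[of v V u] that u V by auto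
    then have "u' \<in> T" using u by (auto simp: T_def S_def u'_def)
    then have "edge_poly G u' \<le> edge_poly G w" by (rule w)
    moreover have "edge_poly G u' = edge_poly G u"
      by (intro edge_poly_cong) (auto simp: u'_def V_def)
    ultimately show "edge_poly G u \<le> edge_poly G w" by simp
  qed
  then show thesis by (rule that)
qed

text \<open>The Lagrange condition multiplied by \<open>w v\<close>. In this form it also covers
  vertices of weight 0.\<close>

lemma optimal_weights_derivative:
  assumes G: "r_graph r G" and r: "r \<noteq> 0" and w: "optimal_weights G w" and v: "v \<in> \<Union>G"
  shows "(\<Sum>e | e \<in> G \<and> v \<in> e. \<Prod>x\<in>e. w x) = real r * edge_poly G w * w v"
proof -
  define lam where "lam = edge_poly G w"
  define d where "d = (\<Sum>e | e \<in> G \<and> v \<in> e. \<Prod>x\<in>e. w x)"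
  have V: "finite (\<Union>G)" using finite_Union_r_graph[OF G] .
  have w0: "\<And>x. x \<in> \<Union>G \<Longrightarrow> 0 \<le> w x" and w1: "(\<Sum>x\<in>\<Union>G. w x) = 1"
    by (fact optimal_weightsD[OF w])+
  \<comment> \<open>\<open>?g t\<close> is the slack in the homogeneous bound after
    \<open>w v\<close> is multiplied by \<open>1 + t\<close>. Such scaling keeps weights nonnegative
    for small \<open>t\<close> of either sign, so 0 is an interior minimum and the derivative
    vanishes there.\<close>
  let ?g = "\<lambda>t. lam * (1 + t * w v) ^ r - (lam + t * d)"
  have "?g 0 \<le> ?g t" if t: "\<bar>0 - t\<bar> < 1" for t
  proof -
    define u where "u = w(v := (1 + t) * w v)"
    have "0 \<le> (1 + t) * w v" using w0[OF v] t by (intro mult_nonneg_nonneg) auto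
    then have u0: "0 \<le> u x" if "x \<in> \<Union>G" for x using w0[OF that] by (simp add: u_def)
    have "(\<Sum>x\<in>\<Union>G. u x) = (\<Sum>x\<in>\<Union>G. w x) + t * w v"
      using V v by (simp add: sum.remove[of "\<Union>G" v] u_def algebra_simps)
    moreover have "edge_poly G u = lam + t * d"
    proof -
      have "(\<Prod>x\<in>e. u x) = (\<Prod>x\<in>e. w x) + (if v \<in> e then t * (\<Prod>x\<in>e. w x) else 0)" if "e \<in> G" for e
      proof (cases "v \<in> e")
        case True
        have "finite e" using r_graphD(3)[OF G that] .
        moreover have "(\<Prod>x\<in>e - {v}. u x) = (\<Prod>x\<in>e - {v}. w x)"
          by (intro prod.cong) (auto simp: u_def)
        ultimately show ?thesis
          using True by (simp add: prod.remove[of e v] u_def algebra_simps)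
      next
        case False
        then show ?thesis by (auto intro!: prod.cong simp: u_def)
      qed
      then show ?thesis using r_graphD(1)[OF G]
        by (simp add: edge_poly_def lam_def d_def sum.distrib sum_distrib_left sum.inter_filter[symmetric])
    qed
    moreover have "edge_poly G u \<le> lam * (\<Sum>x\<in>\<Union>G. u x) ^ r"
      unfolding lam_def by (rule optimal_weights_bound[OF G r w u0])
    ultimately show ?thesis using w1 by simp
  qed
  then have min: "\<forall>t. \<bar>0 - t\<bar> < 1 \<longrightarrow> ?g 0 \<le> ?g t" by blast
  have "(?g has_real_derivative (lam * (real r * w v) - d)) (at 0)"
    by (auto intro!: derivative_eq_intros)
  from DERIV_local_min[OF this _ min] have "lam * (real r * w v) = d" by simp
  then have "d = real r * lam * w v" by (simp only: mult_ac)
  then show ?thesis by (simp add: lam_def d_def)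
qed

lemma lagrangian_pos:
  assumes G: "r_graph r G" and r: "r \<noteq> 0" and ne: "G \<noteq> {}"
  shows "0 < lagrangian G"
proof -
  obtain w where w: "optimal_weights G w" using optimal_weights_exist[OF assms] .
  have "0 < edge_poly G (\<lambda>_. 1)"
    using ne r_graphD(1)[OF G] by (simp add: edge_poly_def card_gt_0_iff)
  also have "\<dots> \<le> edge_poly G w * (\<Sum>v\<in>\<Union>G. 1) ^ r"
    by (rule optimal_weights_bound[OF G r w]) simp
  finally have "edge_poly G w \<noteq> 0" by (metis less_irrefl mult_zero_left)
  moreover have "0 \<le> edge_poly G w"
    using optimal_weightsD(1)[OF w] by (rule edge_poly_nonneg)
  ultimately show ?thesis unfolding lagrangian_eq[OF G r w] by linarith
qed

section \<open>Relabelling of vertices and attainment of the maximum over r-graphs\<close>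

lemma edge_poly_image:
  assumes "inj_on f (\<Union>G)"
  shows "edge_poly ((`) f ` G) w = edge_poly G (w \<circ> f)"
proof -
  have "inj_on ((`) f) G"
    using assms by (auto intro!: inj_onI simp: inj_on_image_eq_iff Union_upper)
  moreover have "inj_on f e" if "e \<in> G" for e
    using assms that by (meson Union_upper inj_on_subset)
  ultimately show ?thesis unfolding edge_poly_def
    by (simp add: sum.reindex prod.reindex)
qed

lemma r_graph_image:
  assumes G: "r_graph r G" and f: "inj_on f (\<Union>G)" "f ` \<Union>G \<subseteq> {1..}"
  shows "r_graph r ((`) f ` G)"
proof -
  have "card (f ` e) = r" if "e \<in> G" for e
    using card_image[of f e] f(1) that r_graphD(4)[OF G that] by (metis Union_upper inj_on_subset)
  then show ?thesis using f(2) r_graphD[OF G] by (auto simp: r_graph_def nsets_def)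
qed

lemma lagrangian_image:
  assumes G: "r_graph r G" and r: "r \<noteq> 0" and ne: "G \<noteq> {}"
    and f: "inj_on f (\<Union>G)" "f ` \<Union>G \<subseteq> {1..}"
  shows "lagrangian ((`) f ` G) = lagrangian G"
proof -
  obtain w where w: "optimal_weights G w" using optimal_weights_exist[OF G r ne] .
  define w' where "w' = w \<circ> inv_into (\<Union>G) f"
  have U: "\<Union>((`) f ` G) = f ` \<Union>G" by auto
  have w': "w' (f v) = w v" if "v \<in> \<Union>G" for v
    using f(1) that by (simp add: w'_def)
  have eq: "edge_poly ((`) f ` G) w' = edge_poly G w"
    unfolding edge_poly_image[OF f(1)] by (intro edge_poly_cong) (simp add: w')
  have "optimal_weights ((`) f ` G) w'"
    unfolding optimal_weights_def U eq
  proof (intro conjI ballI allI impI)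
    show "0 \<le> w' v" if v: "v \<in> f ` \<Union>G" for v
    proof -
      obtain x where "x \<in> \<Union>G" "v = f x" using v by blast
      then show ?thesis using optimal_weightsD(1)[OF w] w' by simp
    qed
    show "(\<Sum>v\<in>f ` \<Union>G. w' v) = 1"
    proof -
      have "(\<Sum>v\<in>f ` \<Union>G. w' v) = (\<Sum>v\<in>\<Union>G. w' (f v))" using f(1) by (simp add: sum.reindex)
      also have "\<dots> = (\<Sum>v\<in>\<Union>G. w v)" by (intro sum.cong refl w')
      finally show ?thesis using optimal_weightsD(2)[OF w] by simp
    qed
    fix u :: "nat \<Rightarrow> real"
    assume u: "\<forall>v\<in>f ` \<Union>G. 0 \<le> u v" "(\<Sum>v\<in>f ` \<Union>G. u v) = 1"
    show "edge_poly ((`) f ` G) u \<le> edge_poly G w"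
      unfolding edge_poly_image[OF f(1)]
    proof (rule optimal_weightsD(3)[OF w])
      show "(\<Sum>v\<in>\<Union>G. (u \<circ> f) v) = 1" using u(2) f(1) by (simp add: sum.reindex)
      show "0 \<le> (u \<circ> f) v" if "v \<in> \<Union>G" for v using u(1) that by (metis comp_apply imageI)
    qed
  qed
  from lagrangian_eq[OF r_graph_image[OF G f] r this] lagrangian_eq[OF G r w] eq
  show ?thesis by simp
qed

lemma card_Union_r_graph:
  assumes "r_graph r G"
  shows "card (\<Union>G) \<le> r * card G"
proof -
  have "card (\<Union>G) \<le> (\<Sum>e\<in>G. card e)"
    by (rule card_Union_le_sum_card)
  also have "\<dots> = r * card G" using r_graphD(4)[OF assms] by simp
  finally show ?thesis .
qed

text \<open>An r-graph with \<open>m\<close> edges has at most \<open>r * m\<close> vertices, so it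
  can be relabelled inside \<open>{1..r * m}\<close>, where there are only finitely many
  r-graphs.\<close>

lemma finite_lagrangians:
  assumes r: "r \<noteq> 0" and m: "m \<noteq> 0"
  shows "finite {lagrangian G | G. r_graph r G \<and> card G = m}"
proof -
  have "lagrangian G \<in> lagrangian ` Pow (nsets {1..r * m} r)" if G: "r_graph r G" "card G = m" for G
  proof -
    have "card (\<Union>G) \<le> card {1..r * m}" using card_Union_r_graph[OF G(1)] G(2) by simp
    then obtain f where f: "f ` \<Union>G \<subseteq> {1..r * m}" "inj_on f (\<Union>G)"
      using card_le_inj[OF finite_Union_r_graph[OF G(1)]] by blast
    have f1: "f ` \<Union>G \<subseteq> {1..}" using f(1) by (rule order_trans) auto
    have G': "r_graph r ((`) f ` G)" using r_graph_image[OF G(1) f(2) f1] .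
    have "(`) f ` G \<in> Pow (nsets {1..r * m} r)"
      using r_graphD[OF G'] f(1) by (fastforce simp: nsets_def)
    moreover have "lagrangian ((`) f ` G) = lagrangian G"
      using G f(2) f1 r m by (intro lagrangian_image) auto
    ultimately show ?thesis by (metis imageI)
  qed
  then have "{lagrangian G | G. r_graph r G \<and> card G = m} \<subseteq> lagrangian ` Pow (nsets {1..r * m} r)"
    by blast
  then show ?thesis by (rule finite_subset) (simp add: finite_imp_finite_nsets)
qed

lemma max_lagrangian_attained:
  assumes r: "r \<noteq> 0" and m: "m \<noteq> 0" and t: "m \<le> t choose r"
  obtains G where "r_graph r G" "card G = m" "max_lagrangian m r = lagrangian G"
    "\<And>G'. r_graph r G' \<Longrightarrow> card G' = m \<Longrightarrow> lagrangian G' \<le> max_lagrangian m r"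
proof -
  let ?L = "{lagrangian G | G. r_graph r G \<and> card G = m}"
  obtain G0 where "G0 \<subseteq> nsets {1..t} r" "card G0 = m"
    using t obtain_subset_with_card_n[of m "nsets {1..t} r"] by auto
  moreover from this have "r_graph r G0"
    using nsets_mono[of "{1..t}" "{1..}" r] finite_subset[OF _ finite_imp_finite_nsets[of "{1..t}" r]]
    by (auto simp: r_graph_def)
  ultimately have "?L \<noteq> {}" by blast
  then have Max: "Max ?L \<in> ?L" "\<And>y. y \<in> ?L \<Longrightarrow> y \<le> Max ?L"
    using finite_lagrangians[OF r m] by (auto intro: Max_in Max_ge simp del: mem_Collect_eq)
  then have "max_lagrangian m r = Max ?L"
    unfolding max_lagrangian_def by (intro Greatest_equality) blast+
  with Max have "max_lagrangian m r \<in> ?L" and le: "\<And>y. y \<in> ?L \<Longrightarrow> y \<le> max_lagrangian m r"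
    by auto
  then obtain G where "r_graph r G" "card G = m" "max_lagrangian m r = lagrangian G" by blast
  then show thesis using that le by blast
qed

section \<open>Entropy bounds on the Lagrangian\<close>

text \<open>
  The law of the first entries in a random ordering of an edge chosen with probability
  \<open>(\<Prod>x\<in>e. w x) / edge_poly G w\<close>.
\<close>
definition tuple_prob :: "nat \<Rightarrow> nat set set \<Rightarrow> (nat \<Rightarrow> real) \<Rightarrow> nat list \<Rightarrow> real" where
  "tuple_prob r G w xs = (if distinct xs
     then fact (r - length xs) / (fact r * edge_poly G w) *
       (\<Sum>e\<in>G. if set xs \<subseteq> e then \<Prod>x\<in>e. w x else 0)
     else 0)"

text \<open>An edge containing \<open>xs\<close> contributes equally to its \<open>r - k\<close>
  one-vertex extensions inside the edge; this factor turns \<open>fact (r - Suc k)\<close> into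
  \<open>fact (r - k)\<close>.\<close>

lemma tuple_prob_marginal:
  assumes G: "r_graph r G" and xs: "length xs < r"
  shows "(\<Sum>v\<in>\<Union>G. tuple_prob r G w (v # xs)) = tuple_prob r G w xs"
proof (cases "distinct xs")
  case True
  define W where "W e = (\<Prod>x\<in>e. w x)" for e
  define k where "k = length xs"
  define C where "C = fact (r - Suc k) / (fact r * edge_poly G w)"
  have V: "finite (\<Union>G)" using finite_Union_r_graph[OF G] .
  have "(\<Sum>v\<in>\<Union>G. tuple_prob r G w (v # xs))
      = (\<Sum>v\<in>\<Union>G. \<Sum>e\<in>G. if v \<in> e - set xs \<and> set xs \<subseteq> e then C * W e else 0)"
    using True by (intro sum.cong)
      (auto simp: tuple_prob_def C_def W_def k_def sum_distrib_left intro!: sum.cong)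
  also have "\<dots> = (\<Sum>e\<in>G. \<Sum>v\<in>\<Union>G. if v \<in> e - set xs \<and> set xs \<subseteq> e then C * W e else 0)"
    by (rule sum.swap)
  also have "\<dots> = (\<Sum>e\<in>G. C * real (r - k) * (if set xs \<subseteq> e then W e else 0))"
  proof (intro sum.cong refl)
    fix e assume e: "e \<in> G"
    show "(\<Sum>v\<in>\<Union>G. if v \<in> e - set xs \<and> set xs \<subseteq> e then C * W e else 0)
        = C * real (r - k) * (if set xs \<subseteq> e then W e else 0)"
    proof (cases "set xs \<subseteq> e")
      case sub: True
      have "{v \<in> \<Union>G. v \<in> e - set xs} = e - set xs" using e by blast
      then have "(\<Sum>v\<in>\<Union>G. if v \<in> e - set xs then C * W e else 0) = real (card (e - set xs)) * (C * W e)"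
        using V by (simp add: sum.inter_filter[symmetric] del: Diff_iff)
      moreover have "card (e - set xs) = r - k"
        using sub r_graphD(3,4)[OF G e] True by (simp add: card_Diff_subset distinct_card k_def)
      ultimately show ?thesis using sub by simp
    qed auto
  qed
  also have "\<dots> = C * real (r - k) * (\<Sum>e\<in>G. if set xs \<subseteq> e then W e else 0)"
    by (simp add: sum_distrib_left)
  also have "C * real (r - k) = fact (r - k) / (fact r * edge_poly G w)"
    using fact_reduce[of "r - k", where 'a = real] xs by (simp add: C_def k_def)
  finally show ?thesis unfolding tuple_prob_def[of r G w xs] W_def k_def using True by simp
qed (simp add: tuple_prob_def)

lemma exchangeable_tuple_prob:
  assumes G: "r_graph r G" and w: "\<And>v. v \<in> \<Union>G \<Longrightarrow> 0 \<le> w v" and pos: "0 < edge_poly G w"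
  shows "exchangeable_tuples (\<Union>G) r (tuple_prob r G w)"
proof
  show "finite (\<Union>G)" using finite_Union_r_graph[OF G] .
  have "0 \<le> (\<Sum>e\<in>G. if set xs \<subseteq> e then \<Prod>x\<in>e. w x else 0)" for xs
    using edge_prod_nonneg[of G w] w by (intro sum_nonneg) simp
  then show "0 \<le> tuple_prob r G w xs" for xs using pos by (auto simp: tuple_prob_def)
  show "tuple_prob r G w [] = 1" using pos by (simp add: tuple_prob_def edge_poly_def)
  show "(\<Sum>v\<in>\<Union>G. tuple_prob r G w (v # xs)) = tuple_prob r G w xs"
    if "length xs < r" "set xs \<subseteq> \<Union>G" for xs
    using tuple_prob_marginal[OF G that(1)] .
  show "tuple_prob r G w (u # v # xs) = tuple_prob r G w (v # u # xs)" for u v xs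
    by (simp add: tuple_prob_def insert_commute conj_commute)
  show "tuple_prob r G w (v # v # xs) = 0" for v xs by (simp add: tuple_prob_def)
qed

text \<open>Optimality enters the probabilistic model here: the Lagrange condition says that one
  entry of the random ordered edge has law \<open>w\<close>.\<close>

lemma tuple_prob_singleton:
  assumes G: "r_graph r G" and r: "r \<noteq> 0" and w: "optimal_weights G w" and v: "v \<in> \<Union>G"
    and pos: "0 < edge_poly G w"
  shows "tuple_prob r G w [v] = w v"
proof -
  have "(\<Sum>e\<in>G. if v \<in> e then \<Prod>x\<in>e. w x else 0) = real r * edge_poly G w * w v"
    using optimal_weights_derivative[OF G r w v] r_graphD(1)[OF G] by (simp add: sum.inter_filter)
  then have "tuple_prob r G w [v] = fact (r - 1) * real r / fact r * w v"
    using pos by (simp add: tuple_prob_def)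
  also have "fact (r - 1) * real r / fact r = 1" using fact_reduce[of r, where 'a = real] r by simp
  finally show ?thesis by simp
qed

lemma tuple_prob_full:
  assumes G: "r_graph r G" and xs: "length xs = r" "distinct xs"
  shows "tuple_prob r G w xs =
    (if set xs \<in> G then (\<Prod>x\<in>set xs. w x) / (fact r * edge_poly G w) else 0)"
proof -
  have "set xs \<subseteq> e \<longleftrightarrow> e = set xs" if "e \<in> G" for e
    using card_subset_eq[OF r_graphD(3)[OF G that], of "set xs"] r_graphD(4)[OF G that] xs
      distinct_card[of xs] by auto
  then have "(\<Sum>e\<in>G. if set xs \<subseteq> e then \<Prod>x\<in>e. w x else 0)
      = (\<Sum>e\<in>G. if e = set xs then \<Prod>x\<in>e. w x else 0)"
    by (intro sum.cong) auto
  also have "\<dots> = (if set xs \<in> G then \<Prod>x\<in>set xs. w x else 0)"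
    using r_graphD(1)[OF G] by simp
  finally show ?thesis using xs by (simp add: tuple_prob_def)
qed

text \<open>The law \<open>p\<close> on unordered edges has entropy at most \<open>ln m\<close>.
  Expanding \<open>ln (p e)\<close> shows that this entropy is \<open>ln lam\<close> plus
  \<open>r\<close> times the entropy of \<open>w\<close>.\<close>

lemma edge_poly_le_entropy:
  assumes G: "r_graph r G" and r: "r \<noteq> 0" and w: "optimal_weights G w"
    and pos: "0 < edge_poly G w"
  defines "N \<equiv> exp (- (\<Sum>v\<in>\<Union>G. w v * ln (w v)))"
  shows "edge_poly G w \<le> real (card G) / N ^ r"
proof -
  define lam where "lam = edge_poly G w"
  define m where "m = real (card G)"
  define p where "p e = (\<Prod>x\<in>e. w x) / lam" for e
  note w0 = optimal_weightsD(1)[OF w]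
  have fin: "finite G" using r_graphD(1)[OF G] .
  have lam: "0 < lam" using pos by (simp add: lam_def)
  have "G \<noteq> {}" using pos by (auto simp: edge_poly_def)
  then have m: "0 < m" using fin by (simp add: m_def card_gt_0_iff)
  have p_sum: "(\<Sum>e\<in>G. p e) = 1"
    using lam by (simp add: p_def sum_divide_distrib[symmetric] lam_def edge_poly_def)
  \<comment> \<open>Gibbs inequality against the uniform law on \<open>G\<close>, term by term; the
    right-hand sides sum to 0.\<close>
  have "p e * (- (\<Sum>x\<in>e. ln (w x)) + ln lam - ln m) \<le> 1 / m - p e" if e: "e \<in> G" for e
  proof (cases "p e = 0")
    case False
    have ne: "w x \<noteq> 0" if "x \<in> e" for x
      using False r_graphD(3)[OF G e] that by (auto simp: p_def)
    have "0 \<le> p e" using edge_prod_nonneg[OF w0 e] lam by (simp add: p_def)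
    then have pe: "0 < p e" using False by simp
    have "ln (p e) = (\<Sum>x\<in>e. ln (w x)) - ln lam"
      using ne r_graphD(3)[OF G e] lam pe by (simp add: p_def ln_div ln_prod zero_less_divide_iff)
    then have "p e * (- (\<Sum>x\<in>e. ln (w x)) + ln lam - ln m) = p e * ln (1 / (p e * m))"
      using pe m by (simp add: ln_div ln_mult)
    also have "\<dots> \<le> p e * (1 / (p e * m) - 1)"
      using pe m by (intro mult_left_mono ln_le_minus_one) auto
    also have "\<dots> = 1 / m - p e" using pe m by (simp add: field_simps)
    finally show ?thesis .
  qed (use m in simp)
  then have "(\<Sum>e\<in>G. p e * (- (\<Sum>x\<in>e. ln (w x)) + ln lam - ln m)) \<le> (\<Sum>e\<in>G. 1 / m - p e)"
    by (rule sum_mono)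
  also have "\<dots> = 0" using m p_sum by (simp add: sum_subtractf m_def)
  also have "(\<Sum>e\<in>G. p e * (- (\<Sum>x\<in>e. ln (w x)) + ln lam - ln m))
      = - (\<Sum>e\<in>G. p e * (\<Sum>x\<in>e. ln (w x))) + (\<Sum>e\<in>G. p e) * (ln lam - ln m)"
    by (simp add: algebra_simps sum.distrib sum_subtractf sum_negf sum_distrib_left)
  \<comment> \<open>Double counting: by the Lagrange condition, the edges through \<open>x\<close>
    have total probability \<open>real r * w x\<close>.\<close>
  also have "(\<Sum>e\<in>G. p e * (\<Sum>x\<in>e. ln (w x))) = real r * (\<Sum>v\<in>\<Union>G. w v * ln (w v))"
  proof -
    have "(\<Sum>e\<in>G. p e * (\<Sum>x\<in>e. ln (w x))) = (\<Sum>e\<in>G. \<Sum>x\<in>\<Union>G. if x \<in> e then p e * ln (w x) else 0)"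
    proof (intro sum.cong refl)
      fix e assume e: "e \<in> G"
      then have "{x \<in> \<Union>G. x \<in> e} = e" by blast
      then show "p e * (\<Sum>x\<in>e. ln (w x)) = (\<Sum>x\<in>\<Union>G. if x \<in> e then p e * ln (w x) else 0)"
        using finite_Union_r_graph[OF G] by (simp add: sum.inter_filter[symmetric] sum_distrib_left)
    qed
    also have "\<dots> = (\<Sum>x\<in>\<Union>G. \<Sum>e\<in>G. if x \<in> e then p e * ln (w x) else 0)"
      by (rule sum.swap)
    also have "\<dots> = (\<Sum>x\<in>\<Union>G. real r * (w x * ln (w x)))"
    proof (intro sum.cong refl)
      fix x assume x: "x \<in> \<Union>G"
      have "(\<Sum>e\<in>G. if x \<in> e then p e * ln (w x) else 0)
          = (\<Sum>e | e \<in> G \<and> x \<in> e. \<Prod>y\<in>e. w y) / lam * ln (w x)"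
        using fin by (simp add: sum.inter_filter[symmetric] p_def sum_divide_distrib sum_distrib_right)
      also have "\<dots> = real r * (w x * ln (w x))"
        unfolding optimal_weights_derivative[OF G r w x] using lam by (simp add: lam_def)
      finally show "(\<Sum>e\<in>G. if x \<in> e then p e * ln (w x) else 0) = real r * (w x * ln (w x))" .
    qed
    finally show ?thesis by (simp add: sum_distrib_left)
  qed
  finally have "ln lam \<le> ln m + real r * (\<Sum>v\<in>\<Union>G. w v * ln (w v))"
    using p_sum by simp
  then have "exp (ln lam) \<le> exp (ln m + real r * (\<Sum>v\<in>\<Union>G. w v * ln (w v)))" by simp
  also have "\<dots> = m * exp (\<Sum>v\<in>\<Union>G. w v * ln (w v)) ^ r"
    using m by (simp add: exp_add exp_of_nat_mult)
  also have "\<dots> = m / N ^ r"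
    by (simp add: N_def exp_minus power_inverse field_simps)
  finally show ?thesis using lam by (simp add: lam_def m_def)
qed

text \<open>For a full ordered edge the log-probability is a sum of \<open>ln (w v)\<close> minus
  \<open>ln (fact r * lam)\<close>. Averaging gives
  \<open>exp (ent r) = fact r * lam * N ^ r\<close>, to which \<open>exp_ent_le\<close>
  applies.\<close>

lemma edge_poly_le_falling:
  assumes G: "r_graph r G" and r: "2 \<le> r" and w: "optimal_weights G w"
    and pos: "0 < edge_poly G w"
  defines "N \<equiv> exp (- (\<Sum>v\<in>\<Union>G. w v * ln (w v)))"
  shows "k < r \<Longrightarrow> real k < N"
    and "fact r * edge_poly G w * N ^ r \<le> (\<Prod>k<r. N - real k)"
    and "fact r * edge_poly G w * N ^ r = (\<Prod>k<r. N - real k) \<Longrightarrow> N \<in> \<nat>"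
proof -
  define lam where "lam = edge_poly G w"
  have w0: "\<And>x. x \<in> \<Union>G \<Longrightarrow> 0 \<le> w x" and w1: "(\<Sum>x\<in>\<Union>G. w x) = 1"
    by (fact optimal_weightsD[OF w])+
  have lam: "0 < lam" using pos by (simp add: lam_def)
  interpret exchangeable_tuples "\<Union>G" r "tuple_prob r G w"
    using exchangeable_tuple_prob[OF G w0 pos] .
  have single: "tuple_prob r G w [v] = w v" if "v \<in> \<Union>G" for v
    using tuple_prob_singleton[OF G _ w that pos] r by simp
  have "ent 1 = - (\<Sum>v\<in>\<Union>G. w v * ln (w v))"
    by (simp add: ent_def sum_tuples_Suc single)
  then have N: "N = exp (ent 1)" by (simp add: N_def)
  have "tuple_prob r G w xs * ln (tuple_prob r G w xs)
      = tuple_prob r G w xs * sum_list (map (\<lambda>v. ln (w v)) xs) - tuple_prob r G w xs * ln (fact r * lam)"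
    if xs: "xs \<in> tuples (\<Union>G) r" for xs
  proof (cases "tuple_prob r G w xs = 0")
    case False
    have d: "distinct xs" by (rule ccontr) (use False in \<open>simp add: tuple_prob_def\<close>)
    have len: "length xs = r" using xs by (simp add: tuplesD)
    then have p: "tuple_prob r G w xs = (\<Prod>x\<in>set xs. w x) / (fact r * lam)"
      using tuple_prob_full[OF G _ d, of w] False by (auto simp: lam_def split: if_splits)
    with False have ne: "\<And>x. x \<in> set xs \<Longrightarrow> w x \<noteq> 0" "(\<Prod>x\<in>set xs. w x) \<noteq> 0" by auto
    then have "ln (tuple_prob r G w xs) = sum_list (map (\<lambda>v. ln (w v)) xs) - ln (fact r * lam)"
      using lam d by (simp add: p ln_div ln_prod sum_list_distinct_conv_sum_set)
    then show ?thesis by (simp only: right_diff_distrib)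
  qed simp
  then have "ent r = - (\<Sum>xs\<in>tuples (\<Union>G) r. tuple_prob r G w xs * sum_list (map (\<lambda>v. ln (w v)) xs))
      + (\<Sum>xs\<in>tuples (\<Union>G) r. tuple_prob r G w xs) * ln (fact r * lam)"
    by (simp add: ent_def sum_subtractf sum_distrib_right)
  also have "\<dots> = real r * ent 1 + ln (fact r * lam)"
    by (simp add: sum_tuples_sum_list mass single ent_def sum_tuples_Suc)
  finally have "exp (ent r) = exp (real r * ent 1) * exp (ln (fact r * lam))" by (simp add: exp_add)
  also have "\<dots> = N ^ r * (fact r * lam)" using lam by (simp add: N exp_of_nat_mult)
  finally have ent_r: "exp (ent r) = fact r * lam * N ^ r" by simp
  show "real k < N" if "k < r" for k using exp_ent_le(1)[OF that] by (simp add: N)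
  show "fact r * edge_poly G w * N ^ r \<le> (\<Prod>k<r. N - real k)"
    using exp_ent_le(2) ent_r by (simp add: N lam_def)
  show "N \<in> \<nat>" if "fact r * edge_poly G w * N ^ r = (\<Prod>k<r. N - real k)"
  proof -
    have eq: "exp (ent r) = (\<Prod>k<r. exp (ent 1) - real k)" using that ent_r by (simp add: N lam_def)
    \<comment> \<open>In the equality case all nonzero weights are \<open>1 / N\<close>; since they
      sum to 1, \<open>N\<close> counts the support.\<close>
    have "w v = (if w v \<noteq> 0 then 1 / N else 0)" if "v \<in> \<Union>G" for v
      using exp_ent_le(3)[OF r eq that] single[OF that] w0[OF that] by (auto simp: N)
    then have "(\<Sum>v\<in>\<Union>G. w v) = (\<Sum>v\<in>\<Union>G. if w v \<noteq> 0 then 1 / N else 0)" by (rule sum.cong[OF refl])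
    also have "\<dots> = real (card {v \<in> \<Union>G. w v \<noteq> 0}) / N"
      using finite_V by (simp add: sum.inter_filter[symmetric])
    finally have "N = real (card {v \<in> \<Union>G. w v \<noteq> 0})" using w1 by (simp add: N field_simps)
    then show ?thesis by (metis of_nat_in_Nats)
  qed
qed

section \<open>Comparison of the two entropy bounds at the real number \<open>x\<close>\<close>

theorem lagrangian_le:
  assumes G: "r_graph r G" and r: "2 \<le> r" and ne: "G \<noteq> {}"
    and x: "real r - 1 < x" and m: "x gchoose r = real (card G)"
  shows "lagrangian G \<le> real (card G) / x ^ r"
    and "lagrangian G = real (card G) / x ^ r \<Longrightarrow> x \<in> \<nat>"
proof -
  have r0: "r \<noteq> 0" using r by simp
  obtain w where w: "optimal_weights G w" using optimal_weights_exist[OF G r0 ne] .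
  define lam where "lam = edge_poly G w"
  have lagr: "lagrangian G = lam" using lagrangian_eq[OF G r0 w] by (simp add: lam_def)
  then have pos: "0 < edge_poly G w" using lagrangian_pos[OF G r0 ne] by (simp add: lam_def)
  define N where "N = exp (- (\<Sum>v\<in>\<Union>G. w v * ln (w v)))"
  have N0: "0 < N" by (simp add: N_def)
  have x0: "0 < x" using x r by simp
  have card: "0 < real (card G)" using ne r_graphD(1)[OF G] by (simp add: card_gt_0_iff)
  have xm: "fact r * real (card G) = (\<Prod>k<r. x - real k)"
    using m[symmetric] by (simp add: gbinomial_prod_rev atLeast0LessThan)
  note upper = edge_poly_le_entropy[OF G r0 w pos, folded N_def lam_def]
  note fall = edge_poly_le_falling[OF G r w pos, folded N_def lam_def]
  \<comment> \<open>For \<open>N < x\<close> the falling-factorial bound is used: each factor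
    \<open>1 - k / N\<close> is at most \<open>1 - k / x\<close>, strictly so for
    \<open>k = 1\<close>, and at \<open>x\<close> the product is
    \<open>fact r * card G / x ^ r\<close>.\<close>
  have "lam < real (card G) / x ^ r" if Nx: "N < x"
  proof -
    have "fact r * lam * N ^ r / N ^ r \<le> (\<Prod>k<r. N - real k) / N ^ r"
      using fall(2) N0 by (intro divide_right_mono) auto
    then have "fact r * lam \<le> (\<Prod>k<r. (N - real k) / N)"
      using N0 by (simp add: prod_dividef)
    also have "\<dots> < (\<Prod>k<r. (x - real k) / x)"
    proof (rule prod_mono_strict[of 1])
      show "(N - real 1) / N < (x - real 1) / x" using Nx N0 x0 by (simp add: field_simps)
      fix k assume k: "k \<in> {..<r}"
      have "real k * N \<le> real k * x" using Nx by (intro mult_left_mono) auto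
      then show "0 \<le> (N - real k) / N \<and> (N - real k) / N \<le> (x - real k) / x"
        using fall(1)[of k] k N0 x0 by (simp add: field_simps)
      show "0 < (x - real k) / x" using x x0 k by auto
    qed (use r in auto)
    also have "\<dots> = fact r * (real (card G) / x ^ r)"
      using xm by (simp add: prod_dividef)
    finally show ?thesis by (rule mult_left_less_imp_less) simp
  qed
  moreover have "real (card G) / N ^ r \<le> real (card G) / x ^ r" if "x \<le> N"
    using that x0 by (intro divide_left_mono power_mono mult_pos_pos) auto
  ultimately show "lagrangian G \<le> real (card G) / x ^ r"
    using upper lagr by fastforce
  show "x \<in> \<nat>" if eq: "lagrangian G = real (card G) / x ^ r"
  proof -
    \<comment> \<open>Equality excludes \<open>N < x\<close> by the strict bound and
      \<open>x < N\<close> by the entropy bound. At \<open>N = x\<close> it becomes equality in the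
      falling-factorial bound, so \<open>N\<close> is a natural number.\<close>
    have "\<not> N < x" using eq lagr \<open>N < x \<Longrightarrow> lam < real (card G) / x ^ r\<close> by auto
    moreover have "\<not> x < N"
    proof
      assume "x < N"
      then have "x ^ r < N ^ r" using x0 r by (intro power_strict_mono) auto
      then have "real (card G) / N ^ r < real (card G) / x ^ r"
        using x0 N0 card by (intro divide_strict_left_mono) auto
      then show False using upper eq lagr by simp
    qed
    ultimately have Nx: "N = x" by simp
    then have "fact r * lam * N ^ r = (\<Prod>k<r. N - real k)"
      using eq lagr xm x0 by simp
    then show ?thesis using fall(3) Nx by simp
  qed
qed

text \<open>The homogeneous bound is tested on the constant weight 1, whose total is at most
  \<open>n\<close>.\<close>

lemma lagrangian_complete_ge:
  assumes r: "r \<noteq> 0" and n: "r \<le> n"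
  shows "r_graph r (nsets {1..n} r)"
    and "real (n choose r) / real n ^ r \<le> lagrangian (nsets {1..n} r)"
proof -
  let ?K = "nsets {1..n} r"
  show K: "r_graph r ?K"
    using nsets_mono[of "{1..n}" "{1..}" r] finite_imp_finite_nsets[of "{1..n}" r]
    by (auto simp: r_graph_def)
  have ne: "?K \<noteq> {}" using n by (auto simp: nsets_eq_empty_iff)
  obtain w where w: "optimal_weights ?K w" using optimal_weights_exist[OF K r ne] .
  have "card (\<Union>?K) \<le> card {1..n}" by (intro card_mono) (auto simp: nsets_def)
  then have "real (card (\<Union>?K)) ^ r \<le> real n ^ r" by (intro power_mono) auto
  then have "edge_poly ?K w * real (card (\<Union>?K)) ^ r \<le> edge_poly ?K w * real n ^ r"
    using optimal_weightsD(1)[OF w] by (intro mult_left_mono edge_poly_nonneg) auto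
  moreover have "real (n choose r) \<le> edge_poly ?K w * real (card (\<Union>?K)) ^ r"
    using optimal_weights_bound[OF K r w, of "\<lambda>_. 1"] by (simp add: edge_poly_def)
  ultimately have "real (n choose r) \<le> edge_poly ?K w * real n ^ r" by linarith
  then show "real (n choose r) / real n ^ r \<le> lagrangian ?K"
    using n r unfolding lagrangian_eq[OF K r w] by (simp add: divide_le_eq)
qed

theorem theoremA1:
  fixes r :: nat
  assumes "r \<ge> 3"
  shows "\<exists>t0::nat. \<forall>t m :: nat. \<forall>x::real.
           t \<ge> t0 \<longrightarrow> (t - 1) choose r < m \<longrightarrow> m \<le> t choose r \<longrightarrow>
           x \<ge> real r - 1 \<longrightarrow> x gchoose r = real m \<longrightarrow>
             max_lagrangian m r \<le> real m * x powi (- int r) \<and>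
             (max_lagrangian m r = real m * x powi (- int r) \<longleftrightarrow> x \<in> \<int>)"
proof (intro exI allI impI)
  fix t m :: nat and x :: real
  \<comment> \<open>This assumption fixes the witness for \<open>t0\<close> as 0.\<close>
  assume "t \<ge> 0" and m_gt: "(t - 1) choose r < m" and m_le: "m \<le> t choose r"
    and x: "x \<ge> real r - 1" and xm: "x gchoose r = real m"
  have m: "m \<noteq> 0" using m_gt by simp
  have r: "r \<noteq> 0" "2 \<le> r" using assms by auto
  \<comment> \<open>At \<open>real r - 1\<close> the last factor of the falling factorial is 0,
    while \<open>m\<close> is positive. The strict inequality makes all factors positive.\<close>
  have "x \<noteq> real r - 1"
  proof
    assume "x = real r - 1"
    then have "(\<Prod>i = 0..<r. x - of_nat i) = 0"
      using r by (intro prod_zero bexI[of _ "r - 1"]) auto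
    then have "x gchoose r = 0" by (simp only: gbinomial_prod_rev div_0)
    then show False using xm m by simp
  qed
  then have x': "real r - 1 < x" using x by simp
  have powi: "real m * x powi (- int r) = real m / x ^ r"
    by (simp add: power_int_minus divide_inverse)
  obtain G where G: "r_graph r G" "card G = m" "max_lagrangian m r = lagrangian G"
    and max: "\<And>G'. r_graph r G' \<Longrightarrow> card G' = m \<Longrightarrow> lagrangian G' \<le> max_lagrangian m r"
    using max_lagrangian_attained[OF r(1) m m_le] by metis
  have ne: "G \<noteq> {}" using G(2) m by auto
  have le: "max_lagrangian m r \<le> real m / x ^ r"
    using lagrangian_le(1)[OF G(1) r(2) ne x'] xm G by simp
  have "x \<in> \<nat>" if "max_lagrangian m r = real m / x ^ r"
    using lagrangian_le(2)[OF G(1) r(2) ne x'] xm G that by simp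
  \<comment> \<open>For integral \<open>x = n\<close> the complete r-graph on \<open>{1..n}\<close>
    has exactly \<open>m\<close> edges and attains the bound.\<close>
  moreover have "max_lagrangian m r = real m / x ^ r" if int: "x \<in> \<int>"
  proof -
    obtain n where n: "x = real n"
    proof -
      have "x \<in> \<nat>" using int x' r by (auto simp: Nats_altdef2)
      then show thesis using that by (auto elim: Nats_cases)
    qed
    have rn: "r \<le> n" using x' n by linarith
    have "m = n choose r" using xm n binomial_gbinomial[of n r, where 'a = real] by simp
    then have "real m / x ^ r \<le> max_lagrangian m r"
      using lagrangian_complete_ge[OF r(1) rn] max[of "nsets {1..n} r"] n by simp
    then show ?thesis using le by simp
  qed
  ultimately show "max_lagrangian m r \<le> real m * x powi (- int r) \<and>
      (max_lagrangian m r = real m * x powi (- int r) \<longleftrightarrow> x \<in> \<int>)"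
    unfolding powi using le Nats_subset_Ints by blast
qed

end
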